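(* Let $K$ be a finite oriented two-dimensional cell complex with cochain spaces $C^q(K)$, $q=0,1,2$, and coboundary operators $d_0,d_1$, and let $\mathcal V=\ker d_0^*\subset C^1(K)$, $\Delta_1=d_0d_0^*+d_1^*d_1$, $\mathcal H^1=\ker\Delta_1\cap\mathcal V$ and $\mathcal V_0=\mathcal V\cap(\mathcal H^1)^\perp$. The following are equivalent: 1. $\mathcal H^1=\{0\}$; 2. there exists $\lambda_*>0$ such that $\langle\Delta_1v,v\rangle\geq\lambda_*\|v\|^2$ for all $v\in\mathcal V$. When $\mathcal H^1\neq\{0\}$, the analogous estimate holds on $\mathcal V_0$ with the smallest positive eigenvalue $\lambda_+$ of the restriction $\Delta_1|_{\mathcal V}$, that is, $\langle\Delta_1v,v\rangle\geq\lambda_+\|v\|^2$ for all $v\in\mathcal V_0$.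
   Context: $K=(K_0,K_1,K_2)$ is a finite oriented two-dimensional cell complex (vertices, edges, faces). The finite-dimensional real cochain spaces $C^q(K)$, $q=0,1,2$, carry fixed Euclidean inner products $\langle\cdot,\cdot\rangle$ with norms $\|\cdot\|$. The coboundary operators $d_0:C^0(K)\to C^1(K)$ and $d_1:C^1(K)\to C^2(K)$ are linear with $d_1d_0=0$; stars denote adjoints and $\perp$ denotes the orthogonal complement. The space $\mathcal V=\ker d_0^*$ is the divergence-free edge-cochain space, and it is invariant under the Hodge Laplacian $\Delta_1=d_0d_0^*+d_1^*d_1$, so that $\Delta_1|_{\mathcal V}$ is an operator from $\mathcal V$ to $\mathcal V$. The harmonic space is $\mathcal H^1=\ker\Delta_1\cap\mathcal V=\ker d_1\cap\ker d_0^*$, and $\mathcal V_0$ is its complementary divergence-free subspace. *)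

theory Defs
  imports "HOL-Analysis.Analysis"
begin

text \<open>
  The cells are arbitrary (possibly empty) subsets of the finite types \<open>'v\<close>, \<open>'e\<close>, \<open>'f\<close>.  The edge
  \<open>e\<close> is oriented from \<open>tail K e\<close> to \<open>head K e\<close> (loops and parallel edges are allowed), and
  \<open>inc K s e\<close> is the incidence number of the oriented face \<open>s\<close> with the oriented edge \<open>e\<close>, that is,
  the number of times, counted with sign, that the boundary of \<open>s\<close> runs through \<open>e\<close>.
\<close>

record ('v, 'e, 'f) cell_complex =
  verts :: "'v set"
  edges :: "'e set"
  faces :: "'f set"
  tail  :: "'e \<Rightarrow> 'v"
  head  :: "'e \<Rightarrow> 'v"
  inc   :: "'f \<Rightarrow> 'e \<Rightarrow> int"

text \<open>
  The last clause says that the boundary of each face is a 1-cycle; it yields \<open>d\<^sub>1 d\<^sub>0 = 0\<close>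
  (lemma \<open>d1_d0\<close> below).
\<close>

definition is_cell_complex :: "('v, 'e, 'f, 'm) cell_complex_scheme \<Rightarrow> bool" where
  "is_cell_complex K \<longleftrightarrow>
     finite (verts K) \<and> finite (edges K) \<and> finite (faces K) \<and>
     (\<forall>e\<in>edges K. tail K e \<in> verts K \<and> head K e \<in> verts K) \<and>
     (\<forall>s\<in>faces K. \<forall>v\<in>verts K.
        (\<Sum>e\<in>edges K. inc K s e * (of_bool (head K e = v) - of_bool (tail K e = v))) = 0)"

definition cochains :: "'a::finite set \<Rightarrow> (real ^ 'a) set" where
  "cochains A = {c. \<forall>i. i \<notin> A \<longrightarrow> c $ i = 0}"

definition inner_product_on :: "'a::real_vector set \<Rightarrow> ('a \<Rightarrow> 'a \<Rightarrow> real) \<Rightarrow> bool" where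
  "inner_product_on S ip \<longleftrightarrow>
     (\<forall>x\<in>S. \<forall>y\<in>S. ip x y = ip y x) \<and>
     (\<forall>x\<in>S. \<forall>y\<in>S. \<forall>z\<in>S. ip (x + y) z = ip x z + ip y z) \<and>
     (\<forall>r. \<forall>x\<in>S. \<forall>y\<in>S. ip (r *\<^sub>R x) y = r * ip x y) \<and>
     (\<forall>x\<in>S. x \<noteq> 0 \<longrightarrow> ip x x > 0)"

text \<open>
  The inner products on the cochain spaces are arbitrary, and in general differ from the
  standard inner product of \<open>real ^ 'a\<close>.
\<close>

record ('v::finite, 'e::finite, 'f::finite) metric_complex = "('v, 'e, 'f) cell_complex" +
  ip0 :: "real ^ 'v \<Rightarrow> real ^ 'v \<Rightarrow> real"
  ip1 :: "real ^ 'e \<Rightarrow> real ^ 'e \<Rightarrow> real"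
  ip2 :: "real ^ 'f \<Rightarrow> real ^ 'f \<Rightarrow> real"

abbreviation C0 :: "('v::finite, 'e::finite, 'f::finite) metric_complex \<Rightarrow> (real ^ 'v) set" where
  "C0 K \<equiv> cochains (verts K)"

abbreviation C1 :: "('v::finite, 'e::finite, 'f::finite) metric_complex \<Rightarrow> (real ^ 'e) set" where
  "C1 K \<equiv> cochains (edges K)"

abbreviation C2 :: "('v::finite, 'e::finite, 'f::finite) metric_complex \<Rightarrow> (real ^ 'f) set" where
  "C2 K \<equiv> cochains (faces K)"

definition is_metric_complex :: "('v::finite, 'e::finite, 'f::finite) metric_complex \<Rightarrow> bool" where
  "is_metric_complex K \<longleftrightarrow> is_cell_complex K \<and>
     inner_product_on (C0 K) (ip0 K) \<and>
     inner_product_on (C1 K) (ip1 K) \<and>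
     inner_product_on (C2 K) (ip2 K)"

definition norm1 :: "('v::finite, 'e::finite, 'f::finite) metric_complex \<Rightarrow> real ^ 'e \<Rightarrow> real" where
  "norm1 K v = sqrt (ip1 K v v)"

definition d0 :: "('v::finite, 'e::finite, 'f::finite) metric_complex \<Rightarrow> real ^ 'v \<Rightarrow> real ^ 'e" where
  "d0 K c = (\<chi> e. if e \<in> edges K then c $ head K e - c $ tail K e else 0)"

definition d1 :: "('v::finite, 'e::finite, 'f::finite) metric_complex \<Rightarrow> real ^ 'e \<Rightarrow> real ^ 'f" where
  "d1 K c = (\<chi> s. if s \<in> faces K then \<Sum>e\<in>edges K. of_int (inc K s e) * c $ e else 0)"

text \<open>
  The adjoint of a linear map from \<open>(S, ipS)\<close> to \<open>(T, ipT)\<close>, evaluated at \<open>y \<in> T\<close>.  The library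
  constant \<open>adjoint\<close> refers to the inner products of the type class and to total maps.
\<close>

definition adjoint_on ::
  "'a set \<Rightarrow> ('a \<Rightarrow> 'a \<Rightarrow> real) \<Rightarrow> ('b \<Rightarrow> 'b \<Rightarrow> real) \<Rightarrow> ('a \<Rightarrow> 'b) \<Rightarrow> 'b \<Rightarrow> 'a" where
  "adjoint_on S ipS ipT f y = (THE z. z \<in> S \<and> (\<forall>x\<in>S. ipT (f x) y = ipS x z))"

definition d0_star :: "('v::finite, 'e::finite, 'f::finite) metric_complex \<Rightarrow> real ^ 'e \<Rightarrow> real ^ 'v" where
  "d0_star K = adjoint_on (C0 K) (ip0 K) (ip1 K) (d0 K)"

definition d1_star :: "('v::finite, 'e::finite, 'f::finite) metric_complex \<Rightarrow> real ^ 'f \<Rightarrow> real ^ 'e" where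
  "d1_star K = adjoint_on (C1 K) (ip1 K) (ip2 K) (d1 K)"

definition laplacian1 :: "('v::finite, 'e::finite, 'f::finite) metric_complex \<Rightarrow> real ^ 'e \<Rightarrow> real ^ 'e" where
  "laplacian1 K v = d0 K (d0_star K v) + d1_star K (d1 K v)"

definition div_free :: "('v::finite, 'e::finite, 'f::finite) metric_complex \<Rightarrow> (real ^ 'e) set" where
  "div_free K = {v \<in> C1 K. d0_star K v = 0}"

definition harmonic :: "('v::finite, 'e::finite, 'f::finite) metric_complex \<Rightarrow> (real ^ 'e) set" where
  "harmonic K = {v \<in> C1 K. laplacian1 K v = 0} \<inter> div_free K"

definition orth1 ::
  "('v::finite, 'e::finite, 'f::finite) metric_complex \<Rightarrow> (real ^ 'e) set \<Rightarrow> (real ^ 'e) set" where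
  "orth1 K W = {v \<in> C1 K. \<forall>w\<in>W. ip1 K v w = 0}"

definition div_free0 :: "('v::finite, 'e::finite, 'f::finite) metric_complex \<Rightarrow> (real ^ 'e) set" where
  "div_free0 K = div_free K \<inter> orth1 K (harmonic K)"

definition pos_eigenvalues :: "('v::finite, 'e::finite, 'f::finite) metric_complex \<Rightarrow> real set" where
  "pos_eigenvalues K = {l. l > 0 \<and> (\<exists>v\<in>div_free K. v \<noteq> 0 \<and> laplacian1 K v = l *\<^sub>R v)}"

text \<open>
  Meaningful when \<open>\<Delta>\<^sub>1\<close> has a positive eigenvalue on the divergence-free space, equivalently when
  \<open>div_free0 K \<noteq> {0}\<close>.
\<close>

definition lambda_plus :: "('v::finite, 'e::finite, 'f::finite) metric_complex \<Rightarrow> real" where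
  "lambda_plus K = (LEAST l. l \<in> pos_eigenvalues K)"


lemma d1_d0:
  assumes "is_cell_complex K"
  shows "d1 K (d0 K c) = 0"
proof (rule vec_eq_iff[THEN iffD2], rule allI)
  fix s
  show "d1 K (d0 K c) $ s = 0 $ s"
  proof (cases "s \<in> faces K")
    case True
    let ?b = "\<lambda>e v. of_bool (head K e = v) - of_bool (tail K e = v) :: int"
    have fin: "finite (verts K)"
      and ends: "\<And>e. e \<in> edges K \<Longrightarrow> tail K e \<in> verts K \<and> head K e \<in> verts K"
      and cyc: "\<And>v. v \<in> verts K \<Longrightarrow> (\<Sum>e\<in>edges K. inc K s e * ?b e v) = 0"
      using assms True unfolding is_cell_complex_def by blast+
    have diff: "c $ head K e - c $ tail K e = (\<Sum>v\<in>verts K. of_int (?b e v) * c $ v)"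
      if "e \<in> edges K" for e
    proof -
      have "(\<Sum>v\<in>verts K. of_bool (a = v) * c $ v) = c $ a" if "a \<in> verts K" for a
      proof -
        have "(\<Sum>v\<in>verts K. of_bool (a = v) * c $ v) = (\<Sum>v\<in>verts K. if a = v then c $ v else 0)"
          by (rule sum.cong) auto
        then show ?thesis using that fin by simp
      qed
      then show ?thesis
        using ends[OF that] by (simp add: left_diff_distrib sum_subtractf)
    qed
    have "d1 K (d0 K c) $ s = (\<Sum>e\<in>edges K. of_int (inc K s e) * (c $ head K e - c $ tail K e))"
      using True by (simp add: d1_def d0_def)
    also have "\<dots> = (\<Sum>e\<in>edges K. \<Sum>v\<in>verts K. of_int (inc K s e * ?b e v) * c $ v)"
      by (rule sum.cong[OF refl]) (simp only: diff sum_distrib_left of_int_mult mult.assoc)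
    also have "\<dots> = (\<Sum>v\<in>verts K. of_int (\<Sum>e\<in>edges K. inc K s e * ?b e v) * c $ v)"
      by (subst sum.swap) (simp only: of_int_sum sum_distrib_right)
    also have "\<dots> = 0"
      by (intro sum.neutral ballI) (simp only: cyc of_int_0 mult_zero_left)
    finally show ?thesis by simp
  qed (simp add: d1_def)
qed

lemma cochains_0 [simp]: "0 \<in> cochains A"
  and cochains_add: "x \<in> cochains A \<Longrightarrow> y \<in> cochains A \<Longrightarrow> x + y \<in> cochains A"
  and cochains_scaleR: "x \<in> cochains A \<Longrightarrow> r *\<^sub>R x \<in> cochains A"
  and axis_cochains: "i \<in> A \<Longrightarrow> axis i 1 \<in> cochains A"
  by (auto simp: cochains_def axis_def)

lemma subspace_cochains: "subspace (cochains A)"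
  by (simp add: subspace_def cochains_add cochains_scaleR)

lemma d0_in_C1: "d0 K c \<in> C1 K" and d1_in_C2: "d1 K c' \<in> C2 K"
  by (auto simp: cochains_def d0_def d1_def)

lemma linear_d0: "linear (d0 K)"
  by (rule linearI) (auto simp: d0_def vec_eq_iff algebra_simps)

lemma linear_d1: "linear (d1 K)"
  by (rule linearI) (auto simp: d1_def vec_eq_iff algebra_simps sum.distrib sum_distrib_left)

lemma cochain_expand:
  assumes "x \<in> cochains A"
  shows "x = (\<Sum>i\<in>A. x $ i *\<^sub>R axis i 1)"
proof -
  have "x = (\<Sum>i\<in>UNIV. x $ i *\<^sub>R axis i 1)"
    using basis_expansion[of x] by (simp add: scalar_mult_eq_scaleR)
  also have "\<dots> = (\<Sum>i\<in>A. x $ i *\<^sub>R axis i 1)"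
    using assms by (intro sum.mono_neutral_right) (auto simp: cochains_def)
  finally show ?thesis .
qed

lemma riesz_cochains:
  fixes A :: "'a::finite set"
  assumes ip: "inner_product_on (cochains A) ip"
    and add: "\<And>x y. x \<in> cochains A \<Longrightarrow> y \<in> cochains A \<Longrightarrow> L (x + y) = L x + L y"
    and scale: "\<And>r x. x \<in> cochains A \<Longrightarrow> L (r *\<^sub>R x) = r * L x"
  shows "\<exists>!z. z \<in> cochains A \<and> (\<forall>x\<in>cochains A. L x = ip x z)"
proof -
  let ?S = "cochains A"
  have sym: "\<And>x y. x \<in> ?S \<Longrightarrow> y \<in> ?S \<Longrightarrow> ip x y = ip y x"
    and ladd: "\<And>x y z. x \<in> ?S \<Longrightarrow> y \<in> ?S \<Longrightarrow> z \<in> ?S \<Longrightarrow> ip (x + y) z = ip x z + ip y z"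
    and lscale: "\<And>r x y. x \<in> ?S \<Longrightarrow> y \<in> ?S \<Longrightarrow> ip (r *\<^sub>R x) y = r * ip x y"
    and pos: "\<And>x. x \<in> ?S \<Longrightarrow> x \<noteq> 0 \<Longrightarrow> ip x x > 0"
    using ip unfolding inner_product_on_def by blast+
  have expand: "M x = (\<Sum>i\<in>A. x $ i * M (axis i 1))"
    if Madd: "\<And>x y. x \<in> ?S \<Longrightarrow> y \<in> ?S \<Longrightarrow> M (x + y) = M x + M y"
      and Mscale: "\<And>r x. x \<in> ?S \<Longrightarrow> M (r *\<^sub>R x) = r * M x"
      and x: "x \<in> ?S" for M :: "real ^ 'a \<Rightarrow> real" and x
  proof -
    have "(\<Sum>i\<in>B. x $ i *\<^sub>R axis i 1) \<in> ?S \<and>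
          M (\<Sum>i\<in>B. x $ i *\<^sub>R axis i 1) = (\<Sum>i\<in>B. x $ i * M (axis i 1))" if "B \<subseteq> A" for B
      using finite[of B] that
    proof (induction B rule: finite_induct)
      case empty
      then show ?case using Mscale[of 0 0] by simp
    next
      case (insert i B)
      have 1: "x $ i *\<^sub>R axis i 1 \<in> ?S" "axis i 1 \<in> ?S"
        using insert.prems by (simp_all add: axis_cochains cochains_scaleR)
      show ?case
        using insert 1 by (auto simp: cochains_add Madd Mscale)
    qed
    then show ?thesis using cochain_expand[OF x] by (metis order_refl)
  qed
  let ?Q = "\<lambda>z. (\<chi> i. if i \<in> A then ip z (axis i 1) else 0)"
  let ?P = "\<lambda>z. ?Q (\<chi> i. if i \<in> A then z $ i else 0)"
  have proj: "(\<chi> i. if i \<in> A then z $ i else 0) = z" if "z \<in> ?S" for z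
    using that by (auto simp: cochains_def vec_eq_iff)
  have projS: "(\<chi> i. if i \<in> A then z $ i else 0) \<in> ?S" for z :: "real ^ 'a"
    by (auto simp: cochains_def)
  have lin: "linear ?P"
  proof (rule linearI)
    fix x y :: "real ^ 'a" and r :: real
    let ?p = "\<lambda>z::real ^ 'a. (\<chi> i. if i \<in> A then z $ i else 0)"
    have p: "?p (x + y) = ?p x + ?p y" "?p (r *\<^sub>R x) = r *\<^sub>R ?p x"
      by (auto simp: vec_eq_iff)
    show "?P (x + y) = ?P x + ?P y"
      unfolding p using projS[of x] projS[of y] by (subst vec_eq_iff) (simp add: ladd axis_cochains)
    show "?P (r *\<^sub>R x) = r *\<^sub>R ?P x"
      unfolding p using projS[of x] by (subst vec_eq_iff) (simp add: lscale axis_cochains)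
  qed
  have inj0: "z = 0" if z: "z \<in> ?S" and P0: "?P z = 0" for z
  proof (rule ccontr)
    assume "z \<noteq> 0"
    have "ip z (axis i 1) = 0" if "i \<in> A" for i
      using P0 that unfolding proj[OF z] by (simp add: vec_eq_iff split: if_splits)
    then have "ip x z = 0" if "x \<in> ?S" for x
      using expand[of "\<lambda>x. ip x z" x] that z
      by (simp add: ladd lscale sym[of _ z] axis_cochains)
    then show False using pos[OF z \<open>z \<noteq> 0\<close>] z by simp
  qed
  have inj: "inj_on ?P ?S"
    by (rule linear_injective_on_subspace_0[OF lin subspace_cochains, THEN iffD2])
      (use inj0 in blast)
  have sub: "?P ` ?S \<subseteq> ?S" by (auto simp: cochains_def)
  have "dim (?P ` ?S) = dim ?S"
    using inj lin subspace_cochains[of A] by (intro dim_image_eq) (simp_all add: span_eq_iff[THEN iffD2])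
  then have "?P ` ?S = ?S"
    using subspace_dim_equal[OF linear_subspace_image[OF lin subspace_cochains] subspace_cochains sub]
    by simp
  moreover have "(\<chi> i. if i \<in> A then L (axis i 1) else 0) \<in> ?S" by (auto simp: cochains_def)
  ultimately obtain z where z: "z \<in> ?S" and zP: "?P z = (\<chi> i. if i \<in> A then L (axis i 1) else 0)"
    by (metis (no_types, lifting) image_iff)
  have ax: "ip z (axis i 1) = L (axis i 1)" if "i \<in> A" for i
    using arg_cong[OF zP, of "\<lambda>c. c $ i"] that unfolding proj[OF z] by simp
  have rep: "L x = ip x z" if "x \<in> ?S" for x
    using expand[of L x] expand[of "\<lambda>x. ip x z" x] that z ax
    by (simp add: add scale ladd lscale sym[of _ z] axis_cochains)
  have uniq: "w = z" if w: "w \<in> ?S" and wrep: "\<forall>x\<in>?S. L x = ip x w" for w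
  proof (rule ccontr)
    assume ne: "w \<noteq> z"
    have mz: "(-1) *\<^sub>R z \<in> ?S" using z by (rule cochains_scaleR)
    then have d: "w - z \<in> ?S" using cochains_add[OF w mz] by simp
    have "ip (w - z) (w - z) = ip w (w - z) - ip z (w - z)"
      using ladd[OF w mz d] lscale[OF z d, of "-1"] by simp
    also have "\<dots> = ip (w - z) w - ip (w - z) z" using sym d w z by simp
    also have "\<dots> = 0" using wrep rep d by simp
    finally show False using pos[OF d] ne by simp
  qed
  show ?thesis using z rep uniq by blast
qed

lemma adjoint_on_cochains:
  assumes "inner_product_on (cochains A) ipS" "inner_product_on (cochains B) ipT"
    and "linear f" "f ` cochains A \<subseteq> cochains B" "y \<in> cochains B"
  shows "adjoint_on (cochains A) ipS ipT f y \<in> cochains A"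
    and "\<And>x. x \<in> cochains A \<Longrightarrow> ipT (f x) y = ipS x (adjoint_on (cochains A) ipS ipT f y)"
proof -
  have "\<exists>!z. z \<in> cochains A \<and> (\<forall>x\<in>cochains A. ipT (f x) y = ipS x z)"
    by (rule riesz_cochains[OF assms(1)])
      (use assms(2-) in \<open>auto simp: inner_product_on_def linear_add linear_scale image_subset_iff\<close>)
  from theI'[OF this, folded adjoint_on_def]
  show "adjoint_on (cochains A) ipS ipT f y \<in> cochains A"
    and "\<And>x. x \<in> cochains A \<Longrightarrow> ipT (f x) y = ipS x (adjoint_on (cochains A) ipS ipT f y)"
    by blast+
qed

lemma d0_star:
  assumes "is_metric_complex K" "y \<in> C1 K"
  shows "d0_star K y \<in> C0 K" "\<And>x. x \<in> C0 K \<Longrightarrow> ip1 K (d0 K x) y = ip0 K x (d0_star K y)"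
  using assms adjoint_on_cochains[of "verts K" "ip0 K" "edges K" "ip1 K" "d0 K" y]
  by (auto simp: is_metric_complex_def d0_star_def linear_d0 d0_in_C1 image_subset_iff)

lemma d1_star:
  assumes "is_metric_complex K" "y \<in> C2 K"
  shows "d1_star K y \<in> C1 K" "\<And>x. x \<in> C1 K \<Longrightarrow> ip2 K (d1 K x) y = ip1 K x (d1_star K y)"
  using assms adjoint_on_cochains[of "edges K" "ip1 K" "faces K" "ip2 K" "d1 K" y]
  by (auto simp: is_metric_complex_def d1_star_def linear_d1 d1_in_C2 image_subset_iff)

lemma laplacian1_div_free:
  assumes K: "is_metric_complex K" and v: "v \<in> div_free K"
  shows "laplacian1 K v \<in> div_free K"
proof -
  let ?w = "d1_star K (d1 K v)"
  have ip: "inner_product_on (C0 K) (ip0 K)" and ip2: "inner_product_on (C2 K) (ip2 K)"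
    and cc: "is_cell_complex K"
    using K by (auto simp: is_metric_complex_def)
  have "laplacian1 K v = ?w"
    using v linear_0[OF linear_d0, of K] by (simp add: laplacian1_def div_free_def)
  moreover have w: "?w \<in> C1 K" by (rule d1_star(1)[OF K d1_in_C2])
  moreover have "d0_star K ?w = 0"
  proof (rule ccontr)
    let ?z = "d0_star K ?w"
    assume "?z \<noteq> 0"
    moreover have z: "?z \<in> C0 K" by (rule d0_star(1)[OF K w])
    ultimately have "ip0 K ?z ?z > 0" using ip by (auto simp: inner_product_on_def)
    moreover have "ip0 K ?z ?z = ip2 K (d1 K (d0 K ?z)) (d1 K v)"
      using d0_star(2)[OF K w z] d1_star(2)[OF K d1_in_C2 d0_in_C1] by simp
    moreover have "ip2 K 0 (d1 K v) = 0"
    proof -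
      have "ip2 K (0 *\<^sub>R 0) (d1 K v) = 0 * ip2 K 0 (d1 K v)"
        using ip2 d1_in_C2[of K v] cochains_0 unfolding inner_product_on_def by blast
      then show ?thesis by simp
    qed
    ultimately show False by (simp add: d1_d0[OF cc])
  qed
  ultimately show ?thesis by (simp add: div_free_def)
qed

end

theory Submission
  imports Defs
begin

text \<open>
  On a divergence-free cochain the Laplacian is \<open>d\<^sub>1\<^sup>* d\<^sub>1\<close>, so its quadratic form is the
  energy \<open>\<parallel>d\<^sub>1 v\<parallel>\<^sup>2\<close>, which vanishes exactly on the harmonic space.  This already shows that a
  nonzero harmonic cochain excludes a uniform positive lower bound (2 implies 1).

  For the other claims the point is finite dimension.  On a nonzero subspace the Rayleigh quotient
  of two symmetric forms attains its minimum by compactness of the unit sphere, and the first-order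
  condition at a minimiser says that it is an eigenvector in the weak sense
  (\<open>rayleigh_minimum\<close>).  The space \<open>\<V>\<^sub>0\<close> is invariant under the Laplacian, so there
  weak eigenvectors are eigenvectors, and the minimum is an eigenvalue; it is positive because
  \<open>\<V>\<^sub>0\<close> meets the harmonic space only in \<open>0\<close>.  Conversely every eigenvector in
  \<open>\<V>\<close> with a positive eigenvalue is orthogonal to the harmonic cochains, because eigenvectors
  of a symmetric operator with different eigenvalues are orthogonal.  Hence the minimum over
  \<open>\<V>\<^sub>0\<close> is the smallest positive eigenvalue on \<open>\<V>\<close>
  (\<open>rayleigh_minimum_is_lambda_plus\<close>).  If there are no harmonic cochains except \<open>0\<close>, then
  \<open>\<V>\<^sub>0 = \<V>\<close>, which gives 1 implies 2.
\<close>

section \<open>Minimising a Rayleigh quotient\<close>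

definition symmetric_form_on :: "'a::real_vector set \<Rightarrow> ('a \<Rightarrow> 'a \<Rightarrow> real) \<Rightarrow> bool" where
  "symmetric_form_on S b \<longleftrightarrow>
     (\<forall>x\<in>S. \<forall>y\<in>S. b x y = b y x) \<and>
     (\<forall>x\<in>S. \<forall>y\<in>S. \<forall>z\<in>S. b (x + y) z = b x z + b y z) \<and>
     (\<forall>r. \<forall>x\<in>S. \<forall>y\<in>S. b (r *\<^sub>R x) y = r * b x y)"

lemma symmetric_form_onD:
  assumes "symmetric_form_on S b"
  shows "x \<in> S \<Longrightarrow> y \<in> S \<Longrightarrow> b x y = b y x"
    and "x \<in> S \<Longrightarrow> y \<in> S \<Longrightarrow> z \<in> S \<Longrightarrow> b (x + y) z = b x z + b y z"
    and "x \<in> S \<Longrightarrow> y \<in> S \<Longrightarrow> b (r *\<^sub>R x) y = r * b x y"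
  using assms unfolding symmetric_form_on_def by blast+

lemma symmetric_form_on_right:
  assumes "symmetric_form_on S b" "subspace S"
  shows "x \<in> S \<Longrightarrow> y \<in> S \<Longrightarrow> z \<in> S \<Longrightarrow> b z (x + y) = b z x + b z y"
    and "x \<in> S \<Longrightarrow> y \<in> S \<Longrightarrow> b y (r *\<^sub>R x) = r * b y x"
proof -
  note sym = symmetric_form_onD(1)[OF assms(1)]
  show "b z (x + y) = b z x + b z y" if "x \<in> S" "y \<in> S" "z \<in> S"
    using sym[of z "x + y"] sym[of z x] sym[of z y] symmetric_form_onD(2)[OF assms(1), of x y z]
      subspace_add[OF assms(2), of x y] that by linarith
  show "b y (r *\<^sub>R x) = r * b y x" if "x \<in> S" "y \<in> S"
    using sym[of y "r *\<^sub>R x"] sym[of y x] symmetric_form_onD(3)[OF assms(1), of x y r]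
      subspace_scale[OF assms(2), of x r] that by simp
qed

lemma inner_product_on_imp_symmetric_form_on:
  "inner_product_on S ip \<Longrightarrow> symmetric_form_on S ip"
  unfolding inner_product_on_def symmetric_form_on_def by (elim conjE) (intro conjI)

lemma inner_product_on_pos: "inner_product_on S ip \<Longrightarrow> x \<in> S \<Longrightarrow> x \<noteq> 0 \<Longrightarrow> 0 < ip x x"
  unfolding inner_product_on_def by (elim conjE) blast

lemma symmetric_form_on_diff_scale:
  assumes "symmetric_form_on S b" "symmetric_form_on S c"
  shows "symmetric_form_on S (\<lambda>x y. b x y - l * c x y)"
  unfolding symmetric_form_on_def
proof (intro conjI allI ballI)
  show "b x y - l * c x y = b y x - l * c y x" if "x \<in> S" "y \<in> S" for x y
    using symmetric_form_onD(1)[OF assms(1) that] symmetric_form_onD(1)[OF assms(2) that] by simp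
qed (simp_all add: symmetric_form_onD(2,3)[OF assms(1)] symmetric_form_onD(2,3)[OF assms(2)]
    algebra_simps)

lemma symmetric_form_on_image:
  assumes "symmetric_form_on T b" "linear f" "f ` S \<subseteq> T"
  shows "symmetric_form_on S (\<lambda>x y. b (f x) (f y))"
proof -
  have f: "f x \<in> T" if "x \<in> S" for x
    using assms(3) that by blast
  show ?thesis
    unfolding symmetric_form_on_def
  proof (intro conjI allI ballI)
    show "b (f x) (f y) = b (f y) (f x)" if "x \<in> S" "y \<in> S" for x y
      using symmetric_form_onD(1)[OF assms(1) f f] that .
  qed (simp_all add: symmetric_form_onD(2,3)[OF assms(1)] f linear_add[OF assms(2)]
      linear_scale[OF assms(2)])
qed

text \<open>
  A form that is given only on \<open>S\<close> becomes a bilinear form on the whole space when composed with a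
  linear projection onto \<open>S\<close>; in finite dimension the latter is continuous.
\<close>

lemma continuous_on_symmetric_form:
  fixes S :: "'a::euclidean_space set"
  assumes S: "subspace S" and b: "symmetric_form_on S b"
  shows "continuous_on S (\<lambda>x. b x x)"
proof -
  obtain p where p: "linear p" "p ` UNIV \<subseteq> S" "\<And>x. x \<in> S \<Longrightarrow> p x = x"
    using linear_exists_left_inverse_on[OF linear_id S inj_on_id] unfolding id_apply by blast
  have bp: "symmetric_form_on UNIV (\<lambda>x y. b (p x) (p y))"
    using b p(1,2) by (rule symmetric_form_on_image)
  have "bilinear (\<lambda>x y. b (p x) (p y))"
    unfolding bilinear_def
    by (intro conjI allI linearI)
      (simp_all add: symmetric_form_onD(2,3)[OF bp] symmetric_form_on_right[OF bp subspace_UNIV])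
  then have "bounded_bilinear (\<lambda>x y. b (p x) (p y))"
    by (simp add: bilinear_conv_bounded_bilinear)
  then have "continuous_on S (\<lambda>x. b (p x) (p x))"
    using continuous_on_id continuous_on_id by (rule bounded_bilinear.continuous_on)
  then show ?thesis
    by (rule continuous_on_eq) (simp add: p(3))
qed

text \<open>
  Otherwise \<open>t \<mapsto> b (w + t y) (w + t y)\<close> would have a nonzero derivative at its zero \<open>t = 0\<close> and
  take negative values.
\<close>

lemma null_vector_in_radical:
  assumes S: "subspace S" and b: "symmetric_form_on S b"
    and nonneg: "\<And>x. x \<in> S \<Longrightarrow> 0 \<le> b x x"
    and w: "w \<in> S" "b w w = 0" and y: "y \<in> S"
  shows "b w y = 0"
proof (rule ccontr)
  assume ne: "b w y \<noteq> 0"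
  have quad: "0 \<le> 2 * t * b w y + t * t * b y y" for t
  proof -
    have ty: "t *\<^sub>R y \<in> S"
      using S y by (rule subspace_scale)
    have wty: "w + t *\<^sub>R y \<in> S"
      using S w(1) ty by (rule subspace_add)
    have "b (w + t *\<^sub>R y) (w + t *\<^sub>R y) = 2 * t * b w y + t * t * b y y"
      using w y ty wty symmetric_form_onD(1)[OF b y w(1)]
      by (simp add: symmetric_form_onD(2,3)[OF b] symmetric_form_on_right[OF b S] algebra_simps)
    then show ?thesis
      using nonneg[OF wty] by simp
  qed
  \<comment> \<open>The denominator exceeds \<open>b y y\<close>, so at \<open>t = - s b w y\<close> the linear term dominates.\<close>
  define s where "s = 1 / (b y y + 1)"
  have s: "0 < s" "s * b y y = 1 - s"
    using nonneg[OF y] by (simp_all add: s_def field_simps)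
  let ?t = "- s * b w y"
  have "2 * ?t * b w y + ?t * ?t * b y y = (b w y)\<^sup>2 * (s * (s * b y y) - 2 * s)"
    by (simp add: algebra_simps power2_eq_square)
  also have "\<dots> = - ((b w y)\<^sup>2 * (s * (1 + s)))"
    unfolding s(2) by (simp add: algebra_simps)
  also have "\<dots> < 0"
    using s(1) ne by simp
  finally show False
    using quad[of ?t] by simp
qed

text \<open>
  The form \<open>b - l ip\<close>, with \<open>l\<close> the minimum of the quotient \<open>b x x / ip x x\<close>, is nonnegative and
  vanishes at a minimiser, which therefore lies in its radical.  The minimum exists because the
  quotient does not change when \<open>x\<close> is scaled, so that it may be taken over the compact Euclidean
  unit sphere, although \<open>ip\<close> need not be the Euclidean inner product.
\<close>

lemma rayleigh_minimum:
  fixes S :: "'a::euclidean_space set"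
  assumes S: "subspace S" "S \<noteq> {0}"
    and ips: "symmetric_form_on S ip" and pos: "\<And>x. x \<in> S \<Longrightarrow> x \<noteq> 0 \<Longrightarrow> 0 < ip x x"
    and b: "symmetric_form_on S b"
  obtains w l where "w \<in> S" "w \<noteq> 0" "\<And>y. y \<in> S \<Longrightarrow> b w y = l * ip w y"
    "\<And>v. v \<in> S \<Longrightarrow> l * ip v v \<le> b v v"
proof -
  let ?U = "S \<inter> sphere 0 1"
  have unit: "(1 / norm x) *\<^sub>R x \<in> ?U" if "x \<in> S" "x \<noteq> 0" for x
    using that S(1) by (simp add: subspace_scale)
  have "compact ?U"
    using closed_subspace[OF S(1)] by (simp add: closed_Int_compact)
  moreover have "?U \<noteq> {}"
    using unit S subspace_0[OF S(1)] by blast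
  moreover have "continuous_on ?U (\<lambda>x. b x x / ip x x)"
  proof (rule continuous_on_divide)
    show "continuous_on ?U (\<lambda>x. b x x)" "continuous_on ?U (\<lambda>x. ip x x)"
      using continuous_on_symmetric_form[OF S(1)] b ips
      by (blast intro: continuous_on_subset)+
    show "\<forall>x\<in>?U. ip x x \<noteq> 0"
      using pos by force
  qed
  ultimately obtain w where w: "w \<in> ?U" and min: "\<And>x. x \<in> ?U \<Longrightarrow> b w w / ip w w \<le> b x x / ip x x"
    using continuous_attains_inf[of ?U "\<lambda>x. b x x / ip x x"] by blast
  define l where "l = b w w / ip w w"
  have wS: "w \<in> S" "w \<noteq> 0"
    using w by auto
  have zero: "b 0 0 = 0" "ip 0 0 = 0"
    using symmetric_form_onD(3)[OF b, of 0 0 0] symmetric_form_onD(3)[OF ips, of 0 0 0]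
      subspace_0[OF S(1)] by simp_all
  have lower: "l * ip v v \<le> b v v" if v: "v \<in> S" for v
  proof (cases "v = 0")
    case False
    have scale: "c (r *\<^sub>R v) (r *\<^sub>R v) = r\<^sup>2 * c v v" if "symmetric_form_on S c" for c r
      using v S(1)
      by (simp add: symmetric_form_onD(3)[OF that] symmetric_form_on_right(2)[OF that S(1)]
          subspace_scale power2_eq_square)
    have "l \<le> b v v / ip v v"
      using min[OF unit[OF v False]] False by (simp add: l_def scale[OF b] scale[OF ips])
    then show ?thesis
      using pos[OF v False] by (simp add: field_simps)
  qed (simp add: zero)
  have "b w y - l * ip w y = 0" if "y \<in> S" for y
    using S(1) symmetric_form_on_diff_scale[OF b ips] _ wS(1) _ that
  proof (rule null_vector_in_radical)
    show "0 \<le> b x x - l * ip x x" if "x \<in> S" for x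
      using lower[OF that] by simp
    show "b w w - l * ip w w = 0"
      using pos[OF wS] by (simp add: l_def)
  qed
  then show thesis
    using that[OF wS _ lower] by simp
qed

section \<open>The Laplacian on divergence-free cochains\<close>

context
  fixes K :: "('v::finite, 'e::finite, 'f::finite) metric_complex"
  assumes K: "is_metric_complex K"
begin

lemma inner_product_ip0: "inner_product_on (C0 K) (ip0 K)"
  and inner_product_ip1: "inner_product_on (C1 K) (ip1 K)"
  and inner_product_ip2: "inner_product_on (C2 K) (ip2 K)"
  using K by (simp_all add: is_metric_complex_def)

lemmas symmetric_form_ip0 = inner_product_on_imp_symmetric_form_on[OF inner_product_ip0]
  and symmetric_form_ip1 = inner_product_on_imp_symmetric_form_on[OF inner_product_ip1]
  and symmetric_form_ip2 = inner_product_on_imp_symmetric_form_on[OF inner_product_ip2]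

lemmas ip0_pos = inner_product_on_pos[OF inner_product_ip0]
  and ip1_pos = inner_product_on_pos[OF inner_product_ip1]
  and ip2_pos = inner_product_on_pos[OF inner_product_ip2]

lemmas ip1_sym = symmetric_form_onD(1)[OF symmetric_form_ip1]
  and ip1_add = symmetric_form_onD(2)[OF symmetric_form_ip1]
  and ip1_scale = symmetric_form_onD(3)[OF symmetric_form_ip1]

lemma ip1_zero [simp]: "y \<in> C1 K \<Longrightarrow> ip1 K 0 y = 0" "y \<in> C1 K \<Longrightarrow> ip1 K y 0 = 0"
  using ip1_scale[of 0 y 0] ip1_sym[of y 0] by simp_all

lemma ip2_self_nonneg: "z \<in> C2 K \<Longrightarrow> 0 \<le> ip2 K z z"
  using ip2_pos[of z] symmetric_form_onD(3)[OF symmetric_form_ip2, of 0 0 0]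
  by (cases "z = 0") auto

lemma norm1_squared: "v \<in> C1 K \<Longrightarrow> (norm1 K v)\<^sup>2 = ip1 K v v"
  using ip1_pos[of v] by (cases "v = 0") (auto simp: norm1_def)

lemma div_free_C1: "v \<in> div_free K \<Longrightarrow> v \<in> C1 K"
  by (simp add: div_free_def)

text \<open>
  Orthogonality to the gradients is a condition linear in \<open>v\<close>, so it exhibits \<open>\<V>\<close> as a subspace;
  the definite description behind \<open>d0_star\<close> hides this.
\<close>

lemma div_free_iff_orth_gradients:
  "v \<in> div_free K \<longleftrightarrow> v \<in> C1 K \<and> (\<forall>x\<in>C0 K. ip1 K v (d0 K x) = 0)"
proof -
  have "d0_star K v = 0 \<longleftrightarrow> (\<forall>x\<in>C0 K. ip1 K v (d0 K x) = 0)" if v: "v \<in> C1 K"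
  proof -
    have eq: "ip1 K v (d0 K x) = ip0 K (d0_star K v) x" if "x \<in> C0 K" for x
      using d0_star[OF K v] that ip1_sym[OF v d0_in_C1]
        symmetric_form_onD(1)[OF symmetric_form_ip0] by metis
    have "ip0 K 0 x = 0" if "x \<in> C0 K" for x
      using symmetric_form_onD(3)[OF symmetric_form_ip0, of 0 x 0] that by simp
    then show ?thesis
      using eq ip0_pos d0_star(1)[OF K v] by (metis less_irrefl)
  qed
  then show ?thesis
    by (auto simp: div_free_def)
qed

lemma subspace_div_free: "subspace (div_free K)"
  by (auto simp: subspace_def div_free_iff_orth_gradients cochains_add cochains_scaleR ip1_add
      ip1_scale d0_in_C1)

lemma laplacian1_weak:
  assumes v: "v \<in> div_free K" and x: "x \<in> C1 K"
  shows "ip1 K (laplacian1 K v) x = ip2 K (d1 K v) (d1 K x)"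
proof -
  have "laplacian1 K v = d1_star K (d1 K v)"
    using v linear_0[OF linear_d0, of K] by (simp add: laplacian1_def div_free_def)
  then show ?thesis
    using d1_star[OF K d1_in_C2[of K v]] x ip1_sym
      symmetric_form_onD(1)[OF symmetric_form_ip2] d1_in_C2 by metis
qed

lemma laplacian1_C1: "v \<in> div_free K \<Longrightarrow> laplacian1 K v \<in> C1 K"
  using laplacian1_div_free[OF K] div_free_C1 by blast

lemma laplacian1_symmetric:
  assumes "v \<in> div_free K" "w \<in> div_free K"
  shows "ip1 K (laplacian1 K v) w = ip1 K v (laplacian1 K w)"
  using assms laplacian1_weak div_free_C1 laplacian1_C1 ip1_sym
    symmetric_form_onD(1)[OF symmetric_form_ip2] d1_in_C2 by metis

lemma laplacian1_nonneg:
  assumes "v \<in> div_free K"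
  shows "0 \<le> ip1 K (laplacian1 K v) v"
  using assms by (simp add: laplacian1_weak div_free_C1 ip2_self_nonneg d1_in_C2)

lemma harmonic_iff: "v \<in> harmonic K \<longleftrightarrow> v \<in> div_free K \<and> laplacian1 K v = 0"
  by (auto simp: harmonic_def div_free_C1)

text \<open>
  Symmetry of the Laplacian gives \<open>\<langle>\<Delta>0, \<Delta>0\<rangle> = \<langle>0, \<Delta>\<Delta>0\<rangle> = 0\<close>.
\<close>

lemma zero_harmonic: "0 \<in> harmonic K"
proof -
  have 0: "0 \<in> div_free K"
    using subspace_div_free by (rule subspace_0)
  let ?y = "laplacian1 K 0"
  have y: "?y \<in> C1 K"
    using 0 by (rule laplacian1_C1)
  have "ip1 K ?y ?y = ip1 K 0 (laplacian1 K ?y)"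
    using laplacian1_symmetric[OF 0 laplacian1_div_free[OF K 0]] .
  then have "ip1 K ?y ?y = 0"
    using laplacian1_C1[OF laplacian1_div_free[OF K 0]] by simp
  then show ?thesis
    using 0 ip1_pos[OF y] by (auto simp: harmonic_iff)
qed

section \<open>The spectral gap above the harmonic space\<close>

lemma div_free0_iff:
  "v \<in> div_free0 K \<longleftrightarrow> v \<in> div_free K \<and> (\<forall>h\<in>harmonic K. ip1 K v h = 0)"
  by (auto simp: div_free0_def orth1_def div_free_C1)

lemma subspace_div_free0: "subspace (div_free0 K)"
proof -
  have "h \<in> C1 K" if "h \<in> harmonic K" for h
    using that by (simp add: harmonic_def)
  then show ?thesis
    using subspace_div_free
    by (auto simp: subspace_def div_free0_iff ip1_add ip1_scale div_free_C1)
qed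

lemma laplacian1_div_free0:
  assumes "v \<in> div_free K"
  shows "laplacian1 K v \<in> div_free0 K"
  using assms laplacian1_div_free[OF K]
  by (auto simp: div_free0_iff harmonic_iff laplacian1_symmetric div_free_C1)

lemma harmonic_div_free0_eq_0:
  assumes "v \<in> harmonic K" "v \<in> div_free0 K"
  shows "v = 0"
  using assms ip1_pos[of v] by (force simp: div_free0_iff div_free_C1)

text \<open>
  A positive eigenvalue \<open>l\<close> makes its eigenvector \<open>v = laplacian1 K v / l\<close> a value of the
  Laplacian, and the range of a symmetric operator is orthogonal to its kernel.
\<close>

lemma pos_eigenvector_div_free0:
  assumes "v \<in> div_free K" "laplacian1 K v = l *\<^sub>R v" "0 < l"
  shows "v \<in> div_free0 K"
proof -
  have "v = (1 / l) *\<^sub>R laplacian1 K v"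
    using assms by simp
  then show ?thesis
    using laplacian1_div_free0[OF assms(1)] subspace_div_free0 by (metis subspace_scale)
qed

text \<open>
  The minimiser \<open>w\<close> satisfies the eigenvalue equation tested against \<open>\<V>\<^sub>0\<close>; testing it
  against the defect \<open>laplacian1 K w - l w\<close>, which lies in \<open>\<V>\<^sub>0\<close> by invariance, shows that the
  defect vanishes.
\<close>

lemma rayleigh_minimum_is_lambda_plus:
  assumes ne: "div_free0 K \<noteq> {0}"
  shows "lambda_plus K \<in> pos_eigenvalues K"
    and "\<And>m. m \<in> pos_eigenvalues K \<Longrightarrow> lambda_plus K \<le> m"
    and "\<And>v. v \<in> div_free0 K \<Longrightarrow> lambda_plus K * (norm1 K v)\<^sup>2 \<le> ip1 K (laplacian1 K v) v"
proof -
  let ?S = "div_free0 K"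
  have df: "v \<in> div_free K" and C1: "v \<in> C1 K" if "v \<in> ?S" for v
    using that by (simp_all add: div_free0_iff div_free_C1)
  have "symmetric_form_on ?S (ip1 K)"
    using symmetric_form_on_image[OF symmetric_form_ip1 linear_id, of ?S] C1 by auto
  moreover have "0 < ip1 K x x" if "x \<in> ?S" "x \<noteq> 0" for x
    using ip1_pos C1 that by simp
  moreover have "symmetric_form_on ?S (\<lambda>x y. ip2 K (d1 K x) (d1 K y))"
    using symmetric_form_ip2 linear_d1
    by (rule symmetric_form_on_image) (auto simp: d1_in_C2)
  ultimately obtain w l where w: "w \<in> ?S" "w \<noteq> 0"
    and weak: "\<And>y. y \<in> ?S \<Longrightarrow> ip2 K (d1 K w) (d1 K y) = l * ip1 K w y"
    and energy: "\<And>v. v \<in> ?S \<Longrightarrow> l * ip1 K v v \<le> ip2 K (d1 K v) (d1 K v)"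
    using rayleigh_minimum[OF subspace_div_free0 ne, where ip = "ip1 K"] by blast
  have lower: "l * ip1 K v v \<le> ip1 K (laplacian1 K v) v" if "v \<in> ?S" for v
    using energy[OF that] by (simp add: laplacian1_weak df C1 that)
  let ?z = "laplacian1 K w + (- l) *\<^sub>R w"
  have z: "?z \<in> ?S"
    using subspace_div_free0 laplacian1_div_free0[OF df[OF w(1)]] w(1)
    by (intro subspace_add subspace_scale)
  have "ip1 K ?z ?z = ip1 K (laplacian1 K w) ?z - l * ip1 K w ?z"
    using ip1_add[of "laplacian1 K w" "(- l) *\<^sub>R w" ?z] ip1_scale[of w ?z "- l"]
      laplacian1_C1[OF df[OF w(1)]] C1[OF w(1)] C1[OF z] cochains_scaleR[of w "edges K" "- l"] by simp
  also have "\<dots> = 0"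
    using weak[OF z] laplacian1_weak[OF df[OF w(1)] C1[OF z]] by simp
  finally have "?z = 0"
    using ip1_pos[OF C1[OF z]] by auto
  then have eigen: "laplacian1 K w = l *\<^sub>R w"
    by simp
  have "l \<noteq> 0"
    using eigen w(2) harmonic_div_free0_eq_0[OF _ w(1)] df[OF w(1)] by (auto simp: harmonic_iff)
  moreover have "0 \<le> l"
    using laplacian1_nonneg[OF df[OF w(1)]] eigen ip1_pos[OF C1[OF w(1)] w(2)]
      ip1_scale[OF C1[OF w(1)] C1[OF w(1)]] by (simp add: zero_le_mult_iff)
  ultimately have mem: "l \<in> pos_eigenvalues K"
    using eigen w(2) df[OF w(1)] unfolding pos_eigenvalues_def by force
  have least: "l \<le> m" if m: "m \<in> pos_eigenvalues K" for m
  proof -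
    obtain v where v: "v \<in> div_free K" "v \<noteq> 0" "laplacian1 K v = m *\<^sub>R v" "0 < m"
      using m unfolding pos_eigenvalues_def by blast
    have "l * ip1 K v v \<le> m * ip1 K v v"
      using lower[OF pos_eigenvector_div_free0[OF v(1,3,4)]] ip1_scale[of v v m] v
      by (simp add: div_free_C1)
    then show ?thesis
      using ip1_pos[of v] v by (simp add: div_free_C1)
  qed
  have "lambda_plus K = l"
    unfolding lambda_plus_def using mem least by (rule Least_equality)
  then show "lambda_plus K \<in> pos_eigenvalues K"
    and "\<And>m. m \<in> pos_eigenvalues K \<Longrightarrow> lambda_plus K \<le> m"
    and "\<And>v. v \<in> ?S \<Longrightarrow> lambda_plus K * (norm1 K v)\<^sup>2 \<le> ip1 K (laplacian1 K v) v"
    using mem least lower by (simp_all add: norm1_squared C1)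
qed

lemma gap_on_div_free0:
  assumes v: "v \<in> div_free0 K"
  shows "lambda_plus K * (norm1 K v)\<^sup>2 \<le> ip1 K (laplacian1 K v) v"
proof (cases "div_free0 K = {0}")
  case True
  then show ?thesis
    using v zero_harmonic by (simp add: norm1_squared harmonic_iff)
next
  case False
  then show ?thesis
    using v by (rule rayleigh_minimum_is_lambda_plus(3))
qed

lemma no_harmonic_iff_coercive:
  "harmonic K = {0} \<longleftrightarrow>
     (\<exists>l>0. \<forall>v\<in>div_free K. l * (norm1 K v)\<^sup>2 \<le> ip1 K (laplacian1 K v) v)"
proof
  assume triv: "harmonic K = {0}"
  have eq: "div_free0 K = div_free K"
    unfolding set_eq_iff div_free0_iff triv by (auto simp: div_free_C1)
  show "\<exists>l>0. \<forall>v\<in>div_free K. l * (norm1 K v)\<^sup>2 \<le> ip1 K (laplacian1 K v) v"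
  proof (cases "div_free0 K = {0}")
    \<comment> \<open>There are no positive eigenvalues here, and any constant serves.\<close>
    case True
    then have "div_free K = {0}"
      by (simp only: eq)
    then show ?thesis
      using zero_harmonic by (intro exI[of _ 1]) (simp add: norm1_squared harmonic_iff)
  next
    case False
    then have "0 < lambda_plus K"
      using rayleigh_minimum_is_lambda_plus(1) unfolding pos_eigenvalues_def by blast
    then show ?thesis
      using gap_on_div_free0[unfolded eq] by blast
  qed
next
  assume "\<exists>l>0. \<forall>v\<in>div_free K. l * (norm1 K v)\<^sup>2 \<le> ip1 K (laplacian1 K v) v"
  then obtain l where l: "0 < l" "\<And>v. v \<in> div_free K \<Longrightarrow> l * (norm1 K v)\<^sup>2 \<le> ip1 K (laplacian1 K v) v"
    by blast
  have "v = 0" if "v \<in> harmonic K" for v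
  proof (rule ccontr)
    assume "v \<noteq> 0"
    with that have "0 < l * ip1 K v v"
      using l(1) ip1_pos by (simp add: harmonic_iff div_free_C1)
    then show False
      using l(2)[of v] that by (simp add: harmonic_iff div_free_C1 norm1_squared)
  qed
  then show "harmonic K = {0}"
    using zero_harmonic by blast
qed

end

theorem theorem1:
  fixes K :: "('v::finite, 'e::finite, 'f::finite) metric_complex"
  assumes "is_metric_complex K"
  shows "(harmonic K = {0} \<longleftrightarrow>
            (\<exists>l>0. \<forall>v\<in>div_free K. ip1 K (laplacian1 K v) v \<ge> l * (norm1 K v)\<^sup>2)) \<and>
         (harmonic K \<noteq> {0} \<longrightarrow>
            (div_free0 K \<noteq> {0} \<longrightarrow>
               lambda_plus K \<in> pos_eigenvalues K \<and>
               (\<forall>l\<in>pos_eigenvalues K. lambda_plus K \<le> l)) \<and>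
            (\<forall>v\<in>div_free0 K. ip1 K (laplacian1 K v) v \<ge> lambda_plus K * (norm1 K v)\<^sup>2))"
  using no_harmonic_iff_coercive[OF assms] rayleigh_minimum_is_lambda_plus(1,2)[OF assms]
    gap_on_div_free0[OF assms] by blast

end
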